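(* Let $X$ be a nonempty countable hereditarily irresolvable completely regular space without isolated points. Then $X$ is ${\rm B}_1^*$-embedded in $\beta X$ and $X$ is not ${\rm B}_1$-embedded in $\beta X$.
   Context: $\beta X$ denotes the Stone–Čech compactification of $X$; completely regular spaces are taken to be Hausdorff, so that $X$ is a subspace of $\beta X$. A function $f:Y\to\mathbb R$ on a topological space $Y$ is Baire-one if it is a pointwise limit of a sequence of continuous real-valued functions on $Y$; ${\rm B}_1(Y)$ is the set of all Baire-one functions on $Y$. A subset $E\subseteq Y$ (with the subspace topology) is ${\rm B}_1$-embedded in $Y$ if every $f\in{\rm B}_1(E)$ extends to some $g\in{\rm B}_1(Y)$; it is ${\rm B}_1^*$-embedded in $Y$ if every bounded $f\in{\rm B}_1(E)$ extends to some $g\in{\rm B}_1(Y)$. A topological space is irresolvable if it is not a union of two disjoint dense subsets; it is hereditarily irresolvable if every nonempty subspace of it is irresolvable. *)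

theory Defs
  imports "HOL-Analysis.Analysis"
begin

section \<open>Resolvability\<close>

definition dense_subset :: "'a topology \<Rightarrow> 'a set \<Rightarrow> bool" where
  "dense_subset Y D \<longleftrightarrow> D \<subseteq> topspace Y \<and> Y closure_of D = topspace Y"

definition irresolvable_space :: "'a topology \<Rightarrow> bool" where
  "irresolvable_space Y \<longleftrightarrow>
    \<not> (\<exists>A B. dense_subset Y A \<and> dense_subset Y B \<and> A \<inter> B = {} \<and> A \<union> B = topspace Y)"

definition hereditarily_irresolvable_space :: "'a topology \<Rightarrow> bool" where
  "hereditarily_irresolvable_space Y \<longleftrightarrow>
    (\<forall>S. S \<subseteq> topspace Y \<and> S \<noteq> {} \<longrightarrow> irresolvable_space (subtopology Y S))"

definition isolated_point :: "'a topology \<Rightarrow> 'a \<Rightarrow> bool" where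
  "isolated_point Y x \<longleftrightarrow> x \<in> topspace Y \<and> openin Y {x}"


section \<open>Baire-one functions and their extension\<close>

text \<open>Real-valued functions on a space are represented by total functions on the underlying type;
  values outside the topspace are irrelevant.\<close>

definition baire_one :: "'a topology \<Rightarrow> ('a \<Rightarrow> real) set" where
  "baire_one Y =
    {f. \<exists>F :: nat \<Rightarrow> 'a \<Rightarrow> real. (\<forall>n. continuous_map Y euclideanreal (F n)) \<and>
          (\<forall>x \<in> topspace Y. (\<lambda>n. F n x) \<longlonglongrightarrow> f x)}"

definition B1_embedded :: "'a topology \<Rightarrow> 'a set \<Rightarrow> bool" where
  "B1_embedded Y E \<longleftrightarrow> E \<subseteq> topspace Y \<and>
    (\<forall>f \<in> baire_one (subtopology Y E). \<exists>g \<in> baire_one Y. \<forall>x \<in> E. g x = f x)"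

definition B1_star_embedded :: "'a topology \<Rightarrow> 'a set \<Rightarrow> bool" where
  "B1_star_embedded Y E \<longleftrightarrow> E \<subseteq> topspace Y \<and>
    (\<forall>f \<in> baire_one (subtopology Y E). bounded (f ` E) \<longrightarrow>
       (\<exists>g \<in> baire_one Y. \<forall>x \<in> E. g x = f x))"


section \<open>The Stone--Cech compactification\<close>

text \<open>The compactification is realised by Tychonoff's construction: the closure, in the cube
  indexed by all continuous maps from the space to the unit interval, of the image of the
  evaluation map. The index maps are taken extensional, so that each continuous map on the
  topspace is counted once.\<close>

definition unit_maps :: "'a topology \<Rightarrow> ('a \<Rightarrow> real) set" where
  "unit_maps X = {f \<in> extensional (topspace X). continuous_map X (top_of_set {0..1}) f}"

definition unit_cube :: "'a topology \<Rightarrow> (('a \<Rightarrow> real) \<Rightarrow> real) topology" where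
  "unit_cube X = product_topology (\<lambda>f. top_of_set {0..1}) (unit_maps X)"

definition stone_cech_map :: "'a topology \<Rightarrow> 'a \<Rightarrow> ('a \<Rightarrow> real) \<Rightarrow> real" where
  "stone_cech_map X x = (\<lambda>f \<in> unit_maps X. f x)"

definition stone_cech :: "'a topology \<Rightarrow> (('a \<Rightarrow> real) \<Rightarrow> real) topology" where
  "stone_cech X =
    subtopology (unit_cube X) (unit_cube X closure_of (stone_cech_map X ` topspace X))"

text \<open>For completely regular Hausdorff spaces this has the characteristic properties: it is a
  compact Hausdorff space containing a dense homeomorphic copy of the space, to which every
  continuous map into the unit interval extends.\<close>

lemma unit_maps_eq:
  "unit_maps X = mspace (submetric (cfunspace X euclidean_metric) {f. f \<in> topspace X \<rightarrow> {0..1}})"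
proof -
  have "f \<in> unit_maps X \<longleftrightarrow> f \<in> mspace (submetric (cfunspace X euclidean_metric) {f. f \<in> topspace X \<rightarrow> {0..1}})" for f
  proof -
    have "bounded (f ` topspace X)" if "f \<in> topspace X \<rightarrow> {0..1}"
      by (rule bounded_subset[OF bounded_closed_interval]) (use that in blast)
    then show ?thesis
      by (simp add: unit_maps_def continuous_map_in_subtopology) blast
  qed
  then show ?thesis by (rule set_eqI)
qed

lemma embedding_map_unit_cube:
  assumes "completely_regular_space X" "Hausdorff_space X"
  shows "embedding_map X (unit_cube X) (stone_cech_map X)"
  using completely_regular_space_cube_embedding_explicit[OF assms]
  unfolding unit_cube_def unit_maps_eq stone_cech_map_def[abs_def] .

lemma stone_cech_map_in_cube:
  "stone_cech_map X ` topspace X \<subseteq> topspace (unit_cube X)"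
proof -
  have "f x \<in> {0..1}" if "f \<in> unit_maps X" "x \<in> topspace X" for f x
    using that by (simp add: unit_maps_def continuous_map_in_subtopology Pi_iff)
  then show ?thesis
    unfolding unit_cube_def stone_cech_map_def topspace_product_topology topspace_euclidean_subtopology
    by (intro image_subsetI) (simp add: PiE_iff)
qed

lemma stone_cech_map_in_closure:
  "stone_cech_map X ` topspace X \<subseteq> unit_cube X closure_of (stone_cech_map X ` topspace X)"
  by (rule closure_of_subset[OF stone_cech_map_in_cube])

lemma topspace_stone_cech:
  "topspace (stone_cech X) = unit_cube X closure_of (stone_cech_map X ` topspace X)"
  by (simp add: stone_cech_def closure_of_subset_topspace inf.absorb2)

lemma compact_space_stone_cech: "compact_space (stone_cech X)"
  unfolding stone_cech_def
proof (rule closedin_compact_space[THEN compact_space_subtopology])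
  show "compact_space (unit_cube X)"
    by (simp add: unit_cube_def compact_space_product_topology compact_space_subtopology)
qed simp

lemma Hausdorff_space_stone_cech: "Hausdorff_space (stone_cech X)"
  by (simp add: stone_cech_def unit_cube_def Hausdorff_space_subtopology
      Hausdorff_space_product_topology)

lemma embedding_map_stone_cech:
  assumes "completely_regular_space X" "Hausdorff_space X"
  shows "embedding_map X (stone_cech X) (stone_cech_map X)"
  using embedding_map_unit_cube[OF assms] stone_cech_map_in_closure[of X]
  by (simp add: stone_cech_def embedding_map_in_subtopology image_subset_iff)

lemma dense_subset_stone_cech:
  "dense_subset (stone_cech X) (stone_cech_map X ` topspace X)"
  using stone_cech_map_in_closure[of X]
  by (simp add: dense_subset_def topspace_stone_cech)
     (simp add: stone_cech_def closure_of_subtopology inf.absorb2)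

lemma stone_cech_extension:
  assumes "continuous_map X (top_of_set {0..1::real}) f"
  shows "\<exists>g. continuous_map (stone_cech X) (top_of_set {0..1}) g \<and>
             (\<forall>x \<in> topspace X. g (stone_cech_map X x) = f x)"
proof (intro exI conjI ballI)
  let ?f = "restrict f (topspace X)"
  have f: "?f \<in> unit_maps X"
    using assms by (auto simp: unit_maps_def intro: continuous_map_eq)
  then show "continuous_map (stone_cech X) (top_of_set {0..1}) (\<lambda>p. p ?f)"
    unfolding stone_cech_def unit_cube_def
    by (intro continuous_map_from_subtopology continuous_map_product_projection)
  show "stone_cech_map X x ?f = f x" if "x \<in> topspace X" for x
    using f that by (simp add: stone_cech_map_def)
qed

end

theory Submission
  imports Defs
begin

text \<open>
  Both halves only use that the compactification is a compact Hausdorff space containing \<open>X\<close>.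
  In a countable space without isolated points, an injective map into the natural numbers is
  Baire-one, being a limit of continuous functions interpolating it at finitely many points.
  By the Baire category theorem an extension of it would be bounded on a nonempty open set, which
  however meets the dense set \<open>X\<close> in infinitely many points.

  For bounded functions a binary expansion reduces the problem to the indicator of a set
  \<open>A \<subseteq> X\<close>. Call an open F-sigma set \<open>U\<close> good if it splits into two F-sigma sets separating
  \<open>A \<inter> U\<close> from \<open>U \<inter> X - A\<close>. Countable unions of good sets are good, and if a good \<open>U\<close> does not
  cover \<open>X\<close>, then irresolvability of \<open>X - U\<close> provides a relatively open piece of it on which \<open>A\<close>
  is trivial, by which \<open>U\<close> can be enlarged. So some good \<open>U\<close> covers \<open>X\<close>, and the Urysohn functions
  of the two F-sigma sets exhibit the indicator of one of them as a Baire-one function.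
\<close>

section \<open>Baire-one functions on countable spaces\<close>

text \<open>Induction on \<open>T\<close>: for a new point \<open>x\<close>, complete regularity
  gives \<open>h\<close> with value 0 at \<open>x\<close> and 1 on the old points, so adding a
  multiple of \<open>1 - h\<close> corrects the value at \<open>x\<close> and leaves the others
  alone.\<close>

lemma finite_interpolation:
  fixes c :: "'a \<Rightarrow> real"
  assumes "completely_regular_space X" "Hausdorff_space X" "finite T" "T \<subseteq> topspace X"
  shows "\<exists>F. continuous_map X euclideanreal F \<and> (\<forall>x\<in>T. F x = c x)"
  using assms(3,4)
proof (induction T)
  case empty
  show ?case by (rule exI[of _ "\<lambda>_. 0"]) simp
next
  case (insert x T)
  then obtain F where F: "continuous_map X euclideanreal F" "\<forall>y\<in>T. F y = c y"
    by auto
  have "closedin X T"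
    using insert assms(2) by (simp add: closedin_Hausdorff_finite)
  then obtain h where h: "continuous_map X euclideanreal h" "h x = 0" "h ` T \<subseteq> {1}"
    using assms(1) insert unfolding completely_regular_space_alt by (metis DiffI insert_subset)
  show ?case
  proof (intro exI conjI ballI)
    show "continuous_map X euclideanreal (\<lambda>y. F y + (c x - F x) * (1 - h y))"
      by (intro continuous_intros F h) auto
    show "F y + (c x - F x) * (1 - h y) = c y" if "y \<in> insert x T" for y
      using that F h insert by auto
  qed
qed

text \<open>The finite sets \<open>T n\<close> increase to the whole space, so functions
  interpolating \<open>f\<close> on \<open>T n\<close> are eventually constant at each
  point.\<close>

lemma countable_imp_baire_one:
  assumes "completely_regular_space X" "Hausdorff_space X" "countable (topspace X)"
  shows "f \<in> baire_one X"
proof -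
  define T where "T n = {x \<in> topspace X. to_nat_on (topspace X) x \<le> n}" for n
  have "finite (T n)" for n
  proof (rule inj_on_finite)
    show "inj_on (to_nat_on (topspace X)) (T n)"
      using inj_on_to_nat_on[OF assms(3)] by (rule inj_on_subset) (auto simp: T_def)
    show "to_nat_on (topspace X) ` T n \<subseteq> {..n}"
      by (auto simp: T_def)
  qed simp
  then have "\<exists>F. continuous_map X euclideanreal F \<and> (\<forall>x\<in>T n. F x = f x)" for n
    by (intro finite_interpolation assms) (auto simp: T_def)
  then obtain F where F: "\<And>n. continuous_map X euclideanreal (F n)" "\<And>n x. x \<in> T n \<Longrightarrow> F n x = f x"
    by metis
  have "(\<lambda>n. F n x) \<longlonglongrightarrow> f x" if "x \<in> topspace X" for x
  proof (rule tendsto_eventually)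
    show "\<forall>\<^sub>F n in sequentially. F n x = f x"
      using eventually_ge_at_top[of "to_nat_on (topspace X) x"]
      by eventually_elim (use F that in \<open>auto simp: T_def\<close>)
  qed
  then show ?thesis
    using F unfolding baire_one_def by blast
qed

section \<open>Unbounded functions without extension\<close>

text \<open>A convergent sequence is bounded, so the space is a countable union of closed sets on
  which the approximating functions share one bound. By Baire one of these has interior, and the
  bound passes to the limit there.\<close>

lemma baire_one_bounded_on_open:
  assumes "compact_space Y" "Hausdorff_space Y" "topspace Y \<noteq> {}" "g \<in> baire_one Y"
  obtains V M where "openin Y V" "V \<noteq> {}" "\<And>p. p \<in> V \<Longrightarrow> \<bar>g p\<bar> \<le> M"
proof -
  obtain F where F: "\<And>n. continuous_map Y euclideanreal (F n)"
    "\<And>x. x \<in> topspace Y \<Longrightarrow> (\<lambda>n. F n x) \<longlonglongrightarrow> g x"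
    using assms(4) unfolding baire_one_def by blast
  define C where "C m = (\<Inter>n. {p \<in> topspace Y. F n p \<in> {- real m..real m}})" for m
  have cl: "closedin Y (C m)" for m
    unfolding C_def
    by (intro closedin_INT closedin_continuous_map_preimage[OF F(1)]) auto
  have "\<Union>(range C) = topspace Y"
  proof
    show "topspace Y \<subseteq> \<Union>(range C)"
    proof
      fix p assume p: "p \<in> topspace Y"
      then have "Bseq (\<lambda>n. F n p)"
        using F(2) convergentI convergent_imp_Bseq by blast
      then obtain K where "\<And>n. \<bar>F n p\<bar> \<le> K"
        by (auto simp: Bseq_def)
      moreover obtain m where "K \<le> real m"
        using real_arch_simple by blast
      ultimately have "\<bar>F n p\<bar> \<le> real m" for n
        using order_trans by blast
      then have "p \<in> C m"
        using p by (auto simp: C_def abs_le_iff minus_le_iff)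
      then show "p \<in> \<Union>(range C)" by blast
    qed
  qed (auto simp: C_def)
  then have "Y interior_of \<Union>(range C) \<noteq> {}"
    using assms(3) by simp
  moreover have "locally_compact_space Y" "regular_space Y"
    using assms compact_imp_locally_compact_space compact_Hausdorff_imp_regular_space by auto
  ultimately have "\<exists>T \<in> range C. \<not> (closedin Y T \<and> Y interior_of T = {})"
    using Baire_category_alt[of Y "range C"] by (metis countable_image countableI_type)
  then obtain m where m: "Y interior_of C m \<noteq> {}"
    using cl by blast
  have "\<bar>g p\<bar> \<le> real m" if "p \<in> Y interior_of C m" for p
  proof -
    have "p \<in> C m"
      using that interior_of_subset[of Y "C m"] by (rule rev_subsetD)
    then have "p \<in> topspace Y" "\<And>n. \<bar>F n p\<bar> \<le> real m"
      by (auto simp: C_def abs_le_iff minus_le_iff)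
    then show ?thesis
      using LIMSEQ_le_const2[OF tendsto_rabs[OF F(2)]] by blast
  qed
  then show thesis
    using that[of "Y interior_of C m" "real m"] m openin_interior_of by blast
qed

text \<open>The function to refute is an injective numbering of \<open>E\<close>. An extension
  bounded on an open \<open>V\<close> leaves only finitely many points of \<open>E\<close> in
  \<open>V\<close>, and these would be isolated in \<open>E\<close>.\<close>

lemma not_B1_embedded_countable_dense:
  assumes Y: "compact_space Y" "Hausdorff_space Y" "topspace Y \<noteq> {}"
    and E: "countable E" "dense_subset Y E" "\<nexists>x. isolated_point (subtopology Y E) x"
  shows "\<not> B1_embedded Y E"
proof
  assume B: "B1_embedded Y E"
  have sub: "E \<subseteq> topspace Y" and cl: "Y closure_of E = topspace Y"
    using E by (auto simp: dense_subset_def)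
  have "completely_regular_space Y"
    using Y by (simp add: compact_Hausdorff_or_regular_imp_normal_space Hausdorff_imp_t1_space
        normal_imp_completely_regular_space)
  then have "(real \<circ> to_nat_on E) \<in> baire_one (subtopology Y E)"
    using Y E(1) sub
    by (intro countable_imp_baire_one completely_regular_space_subtopology
        Hausdorff_space_subtopology) (auto simp: Int_absorb1)
  then obtain g where g: "g \<in> baire_one Y" "\<And>x. x \<in> E \<Longrightarrow> g x = real (to_nat_on E x)"
    using B unfolding B1_embedded_def by fastforce
  obtain V M where V: "openin Y V" "V \<noteq> {}" "\<And>p. p \<in> V \<Longrightarrow> \<bar>g p\<bar> \<le> M"
    using baire_one_bounded_on_open[OF Y g(1)] by blast
  have fin: "finite (V \<inter> E)"
  proof (rule inj_on_finite)
    show "inj_on (to_nat_on E) (V \<inter> E)"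
      using inj_on_to_nat_on[OF E(1)] by (rule inj_on_subset) auto
    show "to_nat_on E ` (V \<inter> E) \<subseteq> {..nat \<lfloor>M\<rfloor>}"
      using V(3) g(2) by (fastforce simp: le_nat_floor)
  qed simp
  obtain x where x: "x \<in> V" "x \<in> E"
    using V cl sub openin_Int_closure_of_eq_empty[OF V(1), of E] openin_subset[OF V(1)] by auto
  \<comment> \<open>Finite sets are closed, so every point of \<open>E\<close> in \<open>V\<close>
    other than \<open>x\<close> can be cut away from \<open>V\<close>.\<close>
  have "closedin Y (V \<inter> E - {x})"
    using fin sub Y(2) by (intro closedin_Hausdorff_finite) auto
  then have "openin Y (V - (V \<inter> E - {x}))"
    using V(1) by blast
  moreover have "(V - (V \<inter> E - {x})) \<inter> E = {x}"
    using x by auto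
  ultimately have "openin (subtopology Y E) {x}"
    by (metis openin_subtopology)
  then show False
    using E(3) x sub by (auto simp: isolated_point_def)
qed

section \<open>Separation by F-sigma sets\<close>

text \<open>The set where a separating function is below 1 is open, and it is the union of the
  closed sets where the function is at most \<open>1 - 1/(n+1)\<close>. It serves to enlarge good
  sets without losing the F-sigma property.\<close>

lemma open_fsigma_neighbourhood:
  assumes "completely_regular_space Y" "openin Y W" "x \<in> W"
  obtains C where "openin Y C" "fsigma_in Y C" "x \<in> C" "C \<subseteq> W"
proof -
  obtain f where f: "continuous_map Y euclideanreal f" "f x = 0" "f ` (topspace Y - W) \<subseteq> {1}"
    using assms unfolding completely_regular_space_alt' by metis
  let ?C = "{p \<in> topspace Y. f p \<in> {..<1}}"
  have "?C = (\<Union>n. {p \<in> topspace Y. f p \<in> {..1 - inverse (real (Suc n))}})" (is "_ = ?D")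
  proof
    show "?C \<subseteq> ?D"
    proof
      fix p assume p: "p \<in> ?C"
      then have "0 < 1 - f p" by simp
      then obtain n where "inverse (real (Suc n)) < 1 - f p"
        using reals_Archimedean by blast
      then have "f p \<le> 1 - inverse (real (Suc n))" by simp
      then show "p \<in> ?D" using p by blast
    qed
    show "?D \<subseteq> ?C"
    proof
      fix p assume "p \<in> ?D"
      then obtain n where "p \<in> topspace Y" "f p \<le> 1 - inverse (real (Suc n))" by auto
      moreover have "inverse (real (Suc n)) > 0" by simp
      ultimately have "p \<in> topspace Y" "f p < 1" by linarith+
      then show "p \<in> ?C" by simp
    qed
  qed
  moreover have "fsigma_in Y ?D"
    by (intro fsigma_in_Union)
      (use closedin_continuous_map_preimage[OF f(1)] in
        \<open>force simp del: atMost_iff intro: closed_imp_fsigma_in\<close>)+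
  ultimately have "fsigma_in Y ?C" by simp
  moreover have "openin Y ?C"
    by (rule openin_continuous_map_preimage[OF f(1)]) simp
  moreover have "x \<in> ?C" "?C \<subseteq> W"
    using assms f openin_subset by fastforce+
  ultimately show thesis using that by blast
qed

text \<open>Separation is stated by disjointness because \<open>A\<close> and \<open>B\<close> may
  reach outside \<open>U\<close>. For \<open>U\<close> the whole space, \<open>P\<close> and
  \<open>Q\<close> are complementary F-sigma sets.\<close>

definition fsigma_splits :: "'a topology \<Rightarrow> 'a set \<Rightarrow> 'a set \<Rightarrow> 'a set \<Rightarrow> bool" where
  "fsigma_splits Y A B U \<longleftrightarrow>
    (\<exists>P Q. fsigma_in Y P \<and> fsigma_in Y Q \<and> P \<inter> Q = {} \<and> P \<union> Q = U \<and>
       B \<inter> P = {} \<and> A \<inter> Q = {})"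

text \<open>As \<open>U\<close> is open, \<open>C - U\<close> is again F-sigma. It misses
  \<open>A\<close> or \<open>B\<close>, hence can be added whole to one of the two parts.\<close>

lemma fsigma_splits_Un:
  assumes U: "openin Y U" "fsigma_splits Y A B U"
    and C: "fsigma_in Y C" "A \<inter> (C - U) = {} \<or> B \<inter> (C - U) = {}"
  shows "fsigma_splits Y A B (U \<union> C)"
proof -
  obtain P Q where PQ: "fsigma_in Y P" "fsigma_in Y Q" "P \<inter> Q = {}" "P \<union> Q = U"
    "B \<inter> P = {}" "A \<inter> Q = {}"
    using U unfolding fsigma_splits_def by blast
  have D: "fsigma_in Y (C - U)"
    using C U by (intro fsigma_in_diff open_imp_gdelta_in)
  show ?thesis
    using C(2)
  proof
    assume "A \<inter> (C - U) = {}"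
    then show ?thesis
      unfolding fsigma_splits_def
      using PQ fsigma_in_Un[OF PQ(2) D] by (intro exI[of _ P] exI[of _ "Q \<union> (C - U)"]) auto
  next
    assume "B \<inter> (C - U) = {}"
    then show ?thesis
      unfolding fsigma_splits_def
      using PQ fsigma_in_Un[OF PQ(1) D] by (intro exI[of _ "P \<union> (C - U)"] exI[of _ Q]) auto
  qed
qed

text \<open>Each point follows the splitting of the first \<open>U n\<close> that contains it.
  Openness of the earlier sets makes their union \<open>D n\<close> a G-delta, so removing it keeps
  the parts F-sigma.\<close>

lemma fsigma_splits_UN:
  fixes U :: "nat \<Rightarrow> 'a set"
  assumes op: "\<And>n. openin Y (U n)" and good: "\<And>n. fsigma_splits Y A B (U n)"
  shows "fsigma_splits Y A B (\<Union>n. U n)"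
proof -
  obtain P Q where PQ: "\<And>n. fsigma_in Y (P n)" "\<And>n. fsigma_in Y (Q n)" "\<And>n. P n \<inter> Q n = {}"
    "\<And>n. P n \<union> Q n = U n" "\<And>n. B \<inter> P n = {}" "\<And>n. A \<inter> Q n = {}"
    using good unfolding fsigma_splits_def by metis
  define D where "D n = (\<Union>k<n. U k)" for n
  have D: "gdelta_in Y (D n)" for n
    unfolding D_def by (intro open_imp_gdelta_in openin_Union) (auto intro: op)
  have disj: "(P m - D m) \<inter> (Q n - D n) = {}" for m n
  proof (cases m n rule: linorder_cases)
    case less
    then have "P m \<subseteq> D n" using PQ(4) by (auto simp: D_def)
    then show ?thesis by auto
  next
    case equal
    then show ?thesis using PQ(3) by auto
  next
    case greater
    then have "Q n \<subseteq> D m" using PQ(4) by (auto simp: D_def)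
    then show ?thesis by auto
  qed
  have cover: "(\<Union>n. P n - D n) \<union> (\<Union>n. Q n - D n) = (\<Union>n. U n)"
  proof
    show "(\<Union>n. U n) \<subseteq> (\<Union>n. P n - D n) \<union> (\<Union>n. Q n - D n)"
    proof
      fix p assume "p \<in> (\<Union>n. U n)"
      then have ex: "\<exists>n. p \<in> U n" by blast
      let ?n = "LEAST n. p \<in> U n"
      have "p \<in> U ?n" using ex by (rule LeastI_ex)
      moreover have "p \<notin> D ?n" using not_less_Least by (auto simp: D_def)
      ultimately show "p \<in> (\<Union>n. P n - D n) \<union> (\<Union>n. Q n - D n)"
        using PQ(4) by blast
    qed
  qed (use PQ(4) in blast)
  have "fsigma_in Y (\<Union>n. P n - D n)" "fsigma_in Y (\<Union>n. Q n - D n)"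
    by (intro fsigma_in_Union; auto intro: fsigma_in_diff PQ D)+
  then show ?thesis
    unfolding fsigma_splits_def
    by (intro exI[of _ "\<Union>n. P n - D n"] exI[of _ "\<Union>n. Q n - D n"] conjI cover)
      (use disj PQ(5,6) in blast)+
qed

text \<open>\<open>S \<inter> A\<close> and \<open>S - A\<close> cannot both be dense in
  \<open>S\<close>; whichever is not dense misses a nonempty relatively open set.\<close>

lemma hereditarily_irresolvable_trivial_piece:
  assumes "hereditarily_irresolvable_space X" "S \<subseteq> topspace X" "S \<noteq> {}"
  obtains W where "openin X W" "W \<inter> S \<noteq> {}" "W \<inter> S \<subseteq> A \<or> W \<inter> S \<inter> A = {}"
proof -
  let ?S = "subtopology X S"
  have top: "topspace ?S = S" using assms by auto
  have irr: "irresolvable_space ?S"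
    using assms unfolding hereditarily_irresolvable_space_def by blast
  have "\<not> (dense_subset ?S (S \<inter> A) \<and> dense_subset ?S (S - A))"
  proof
    assume "dense_subset ?S (S \<inter> A) \<and> dense_subset ?S (S - A)"
    moreover have "(S \<inter> A) \<inter> (S - A) = {}" "(S \<inter> A) \<union> (S - A) = topspace ?S"
      using top by auto
    ultimately show False using irr unfolding irresolvable_space_def by blast
  qed
  then obtain D where D: "D = S \<inter> A \<or> D = S - A" "\<not> dense_subset ?S D" by blast
  then have "D \<subseteq> S" by blast
  then have "?S closure_of D \<noteq> topspace ?S"
    using D(2) unfolding dense_subset_def top by blast
  then obtain T where T: "openin ?S T" "T \<noteq> {}" "D \<inter> T = {}"
    unfolding dense_intersects_open by blast
  then obtain W where W: "openin X W" "T = W \<inter> S"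
    by (auto simp: openin_subtopology)
  then show thesis using that[of W] T D by blast
qed

text \<open>Countability of \<open>E\<close> replaces a transfinite exhaustion: one good set per
  point of \<open>E\<close> suffices to build a good \<open>U\<close> containing every point of
  \<open>E\<close> that any good set contains.\<close>

lemma hereditarily_irresolvable_fsigma_split:
  assumes Y: "completely_regular_space Y" and E: "E \<subseteq> topspace Y" "countable E"
    and irr: "hereditarily_irresolvable_space (subtopology Y E)" and A: "A \<subseteq> E"
  shows "fsigma_splits Y A (E - A) (topspace Y)"
proof -
  define good where
    "good U \<longleftrightarrow> openin Y U \<and> fsigma_in Y U \<and> fsigma_splits Y A (E - A) U" for U
  have good_empty: "good {}"
    unfolding good_def fsigma_splits_def by force
  have good_UN: "good (\<Union>n. U n)" if "\<And>n. good (U n)" for U :: "nat \<Rightarrow> 'a set"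
    using that unfolding good_def
    by (auto intro!: fsigma_splits_UN fsigma_in_Union)
  \<comment> \<open>The empty set is the default for points in no good set. Thus \<open>u x\<close>
    is good for every \<open>x\<close>, and the union below is good even if \<open>E\<close> is
    empty.\<close>
  have "\<exists>U. good U \<and> (x \<in> \<Union>(Collect good) \<longrightarrow> x \<in> U)" for x
    using good_empty by blast
  then obtain u where u: "\<And>x. good (u x)" "\<And>x. x \<in> \<Union>(Collect good) \<Longrightarrow> x \<in> u x"
    by metis
  define U where "U = (\<Union>n. u (from_nat_into E n))"
  have U: "good U"
    unfolding U_def by (intro good_UN u)
  have max: "x \<in> U" if x: "x \<in> E" "x \<in> V" "good V" for x V
  proof -
    have "x \<in> u x" using u(2) x by blast
    then show ?thesis
      unfolding U_def by (metis UN_I UNIV_I E(2) from_nat_into_to_nat_on x(1))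
  qed
  have "E \<subseteq> U"
  proof (rule ccontr)
    assume "\<not> E \<subseteq> U"
    then have "E - U \<subseteq> topspace (subtopology Y E)" "E - U \<noteq> {}"
      using E by auto
    then obtain W' where W': "openin (subtopology Y E) W'" "W' \<inter> (E - U) \<noteq> {}"
      "W' \<inter> (E - U) \<subseteq> A \<or> W' \<inter> (E - U) \<inter> A = {}"
      using hereditarily_irresolvable_trivial_piece[OF irr] by metis
    then obtain W where W: "openin Y W" "W' = W \<inter> E"
      by (auto simp: openin_subtopology)
    obtain x where x: "x \<in> W" "x \<in> E" "x \<notin> U" using W' W by auto
    obtain C where C: "openin Y C" "fsigma_in Y C" "x \<in> C" "C \<subseteq> W"
      using open_fsigma_neighbourhood[OF Y W(1) x(1)] by blast
    have "A \<inter> (C - U) = {} \<or> (E - A) \<inter> (C - U) = {}"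
      using W'(3) W C A by blast
    then have "good (U \<union> C)"
      using U C unfolding good_def by (auto intro: fsigma_splits_Un fsigma_in_Un)
    then show False using max x C by blast
  qed
  \<comment> \<open>What remains outside \<open>U\<close> contains no point of \<open>E\<close>, so
    it can be attached as one more trivial piece.\<close>
  then have "A \<inter> (topspace Y - U) = {}" using A by blast
  moreover have "fsigma_in Y (topspace Y)" by simp
  moreover have "U \<union> topspace Y = topspace Y"
    using U openin_subset unfolding good_def by blast
  ultimately show ?thesis
    using fsigma_splits_Un[of Y U A "E - A" "topspace Y"] U unfolding good_def by auto
qed

section \<open>Extension of bounded functions\<close>

text \<open>Write \<open>P\<close> and \<open>Q\<close> as increasing unions of closed sets
  \<open>C n\<close> and \<open>D n\<close>. The Urysohn function of the \<open>n\<close>-th pair is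
  eventually 1 at points of \<open>P\<close> and -1 at points of \<open>Q\<close>. The uniform bound
  on \<open>h\<close> later gives a summable majorant.\<close>

lemma fsigma_split_urysohn:
  assumes "normal_space Y" "fsigma_splits Y A B (topspace Y)"
    "A \<subseteq> topspace Y" "B \<subseteq> topspace Y"
  obtains h :: "nat \<Rightarrow> 'a \<Rightarrow> real" and g where
    "\<And>n. continuous_map Y euclideanreal (h n)" "\<And>n p. p \<in> topspace Y \<Longrightarrow> \<bar>h n p\<bar> \<le> 1"
    "\<And>p. p \<in> topspace Y \<Longrightarrow> (\<lambda>n. h n p) \<longlonglongrightarrow> g p"
    "\<And>p. p \<in> A \<Longrightarrow> g p = 1" "\<And>p. p \<in> B \<Longrightarrow> g p = -1"
proof -
  obtain P Q where PQ: "fsigma_in Y P" "fsigma_in Y Q" "P \<inter> Q = {}" "P \<union> Q = topspace Y"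
    "B \<inter> P = {}" "A \<inter> Q = {}"
    using assms(2) unfolding fsigma_splits_def by blast
  obtain C D where C: "\<And>n. closedin Y (C n)" "\<And>n. C n \<subseteq> C (Suc n)" "\<Union>(range C) = P"
    and D: "\<And>n. closedin Y (D n)" "\<And>n. D n \<subseteq> D (Suc n)" "\<Union>(range D) = Q"
    using PQ(1,2) unfolding fsigma_in_ascending by metis
  have mono: "incseq C" "incseq D"
    using C(2) D(2) by (simp_all add: incseq_Suc_iff)
  have "\<exists>f. continuous_map Y (top_of_set {-1..1::real}) f \<and> f ` D n \<subseteq> {-1} \<and> f ` C n \<subseteq> {1}" for n
  proof -
    have "disjnt (D n) (C n)" using C(3) D(3) PQ(3) unfolding disjnt_def by blast
    then show ?thesis
      using Urysohn_lemma[OF assms(1) D(1) C(1), where a = "-1" and b = 1] by (metis le_minus_one_simps(2))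
  qed
  then obtain h where h: "\<And>n. continuous_map Y (top_of_set {-1..1::real}) (h n)"
    "\<And>n. h n ` D n \<subseteq> {-1}" "\<And>n. h n ` C n \<subseteq> {1}"
    by metis
  define g :: "'a \<Rightarrow> real" where "g p = (if p \<in> P then 1 else -1)" for p
  show thesis
  proof (rule that[of h g])
    show "continuous_map Y euclideanreal (h n)" for n
      using h(1) by (simp add: continuous_map_in_subtopology)
    show "\<bar>h n p\<bar> \<le> 1" if "p \<in> topspace Y" for n p
      using h(1)[of n] that by (auto simp: continuous_map_in_subtopology abs_le_iff minus_le_iff)
    show "(\<lambda>n. h n p) \<longlonglongrightarrow> g p" if p: "p \<in> topspace Y" for p
    proof (rule tendsto_eventually)
      show "\<forall>\<^sub>F n in sequentially. h n p = g p"
      proof (cases "p \<in> P")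
        case True
        then obtain m where m: "p \<in> C m" using C(3) by blast
        show ?thesis
          using eventually_ge_at_top[of m]
        proof eventually_elim
          case (elim n)
          then have "p \<in> C n" using m mono(1) by (auto simp: incseq_def)
          then show ?case using h(3) True by (auto simp: g_def)
        qed
      next
        case False
        then have "p \<in> Q" using p PQ by blast
        then obtain m where m: "p \<in> D m" using D(3) by blast
        show ?thesis
          using eventually_ge_at_top[of m]
        proof eventually_elim
          case (elim n)
          then have "p \<in> D n" using m mono(2) by (auto simp: incseq_def)
          then show ?case using h(2) False by (auto simp: g_def)
        qed
      qed
    qed
    show "g p = 1" if "p \<in> A" for p
      using that PQ assms(3) by (auto simp: g_def)
    show "g p = -1" if "p \<in> B" for p
      using that PQ by (auto simp: g_def)
  qed
qed

text \<open>A diagonal choice: the \<open>n\<close>-th approximation adds the \<open>n\<close>-th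
  approximants of the first \<open>n\<close> terms. Tannery's theorem, dominated convergence for
  series, identifies the limit.\<close>

lemma baire_one_suminf:
  fixes h :: "nat \<Rightarrow> nat \<Rightarrow> 'a \<Rightarrow> real"
  assumes cont: "\<And>k n. continuous_map Y euclideanreal (h k n)"
    and bound: "\<And>k n p. p \<in> topspace Y \<Longrightarrow> \<bar>h k n p\<bar> \<le> M k" and "summable M"
    and lim: "\<And>k p. p \<in> topspace Y \<Longrightarrow> (\<lambda>n. h k n p) \<longlonglongrightarrow> g k p"
  shows "(\<lambda>p. \<Sum>k. g k p) \<in> baire_one Y"
proof -
  have "continuous_map Y euclideanreal (\<lambda>p. \<Sum>k<n. h k n p)" for n
    by (intro continuous_map_sum cont) auto
  moreover have "(\<lambda>n. \<Sum>k<n. h k n p) \<longlonglongrightarrow> (\<Sum>k. g k p)" if p: "p \<in> topspace Y" for p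
  proof -
    \<comment> \<open>Padding with zeros turns the finite sums into series indexed by all
      \<open>k\<close> with the common majorant \<open>M\<close>.\<close>
    define a where "a k n = (if k < n then h k n p else 0)" for k n
    have M: "M k \<ge> 0" for k
      using bound[OF p] by (meson abs_ge_zero order_trans)
    have "(\<lambda>n. a k n) \<longlonglongrightarrow> g k p" for k
      using lim[OF p]
    proof (rule Lim_transform_eventually)
      show "\<forall>\<^sub>F n in sequentially. h k n p = a k n"
        using eventually_gt_at_top[of k] by eventually_elim (simp add: a_def)
    qed
    moreover have "\<forall>\<^sub>F (k, n) in at_top \<times>\<^sub>F sequentially. norm (a k n) \<le> M k"
      using bound[OF p] M by (intro always_eventually) (auto simp: a_def)
    ultimately have "(\<lambda>n. \<Sum>k. a k n) \<longlonglongrightarrow> (\<Sum>k. g k p)"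
      using tannerys_theorem[of a "\<lambda>k. g k p" sequentially M] assms(3) by auto
    moreover have "(\<Sum>k. a k n) = (\<Sum>k<n. h k n p)" for n
    proof -
      have "(\<Sum>k. a k n) = (\<Sum>k<n. a k n)"
        by (rule suminf_finite) (auto simp: a_def)
      then show ?thesis by (simp add: a_def)
    qed
    ultimately show ?thesis by simp
  qed
  ultimately show ?thesis
    unfolding baire_one_def by (intro CollectI exI[of _ "\<lambda>n p. \<Sum>k<n. h k n p"]) blast
qed

text \<open>Greedy digits: the \<open>k\<close>-th sign is that of the remainder
  \<open>r y k\<close> left by the earlier terms.\<close>

lemma signed_binary_expansion:
  fixes M :: real
  assumes "M \<ge> 0"
  obtains s :: "nat \<Rightarrow> real \<Rightarrow> bool" where
    "\<And>y. \<bar>y\<bar> \<le> M \<Longrightarrow> (\<lambda>k. (if s k y then 1 else -1) * (M / 2 ^ Suc k)) sums y"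
proof -
  define r where
    "r = (\<lambda>y::real. rec_nat y (\<lambda>n z. z - (if z \<ge> 0 then 1 else -1) * (M / 2 ^ Suc n)))"
  have r_simps: "r y 0 = y" "r y (Suc n) = r y n - (if r y n \<ge> 0 then 1 else -1) * (M / 2 ^ Suc n)"
    for y n by (simp_all add: r_def)
  show thesis
  proof (rule that[of "\<lambda>k y. r y k \<ge> 0"])
    fix y :: real assume y: "\<bar>y\<bar> \<le> M"
    have part: "(\<Sum>k<n. (if r y k \<ge> 0 then 1 else -1) * (M / 2 ^ Suc k)) = y - r y n" for n
      by (induction n) (simp_all add: r_simps)
    have bnd: "\<bar>r y n\<bar> \<le> M / 2 ^ n" for n
    proof (induction n)
      case (Suc n)
      \<comment> \<open>The step moves the remainder towards 0 by half of the old bound, so the new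
        remainder is at most that half.\<close>
      have "M / 2 ^ n = 2 * (M / 2 ^ Suc n)" by simp
      then show ?case using Suc assms unfolding r_simps(2) by (auto simp: abs_if split: if_splits)
    qed (use y in \<open>simp add: r_simps\<close>)
    have "(\<lambda>n. M * (1/2) ^ n) \<longlonglongrightarrow> M * 0"
      by (intro tendsto_mult_left LIMSEQ_realpow_zero) auto
    then have "(\<lambda>n. M / 2 ^ n) \<longlonglongrightarrow> 0"
      by (simp add: power_one_over)
    then have "(\<lambda>n. r y n) \<longlonglongrightarrow> 0"
      using bnd by (intro Lim_null_comparison[of "r y"] always_eventually) auto
    then have "(\<lambda>n. y - r y n) \<longlonglongrightarrow> y - 0"
      by (intro tendsto_diff tendsto_const)
    then show "(\<lambda>k. (if r y k \<ge> 0 then 1 else -1) * (M / 2 ^ Suc k)) sums y"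
      unfolding sums_def part by simp
  qed
qed

text \<open>Expand the values of \<open>f\<close> in signed binary digits. The set
  \<open>A k\<close> where digit \<open>k\<close> is positive is separated from
  \<open>E - A k\<close> by F-sigma sets, so each digit extends to a Baire-one \<open>g k\<close> on
  \<open>Y\<close>, and the weighted sum of these extends \<open>f\<close>.\<close>

lemma B1_star_embedded_countable_irresolvable:
  assumes Y: "normal_space Y" "Hausdorff_space Y" and E: "E \<subseteq> topspace Y" "countable E"
    and irr: "hereditarily_irresolvable_space (subtopology Y E)"
  shows "B1_star_embedded Y E"
  unfolding B1_star_embedded_def
proof (intro conjI ballI impI E)
  fix f :: "'a \<Rightarrow> real" assume "bounded (f ` E)"
  then obtain M where M: "M > 0" "\<And>x. x \<in> E \<Longrightarrow> \<bar>f x\<bar> \<le> M"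
    unfolding bounded_pos by auto
  obtain s where s: "\<And>y. \<bar>y\<bar> \<le> M \<Longrightarrow> (\<lambda>k. (if s k y then 1 else -1) * (M / 2 ^ Suc k)) sums y"
    using signed_binary_expansion[of M] M(1) by (metis less_imp_le)
  define A where "A k = {x \<in> E. s k (f x)}" for k :: nat
  have cr: "completely_regular_space Y"
    using Y by (simp add: Hausdorff_imp_t1_space normal_imp_completely_regular_space)
  have "\<exists>h g. (\<forall>n. continuous_map Y euclideanreal (h n)) \<and> (\<forall>n. \<forall>p \<in> topspace Y. \<bar>h n p\<bar> \<le> 1) \<and>
    (\<forall>p \<in> topspace Y. (\<lambda>n. h n p) \<longlonglongrightarrow> g p) \<and> (\<forall>p \<in> A k. g p = 1) \<and> (\<forall>p \<in> E - A k. g p = -1)"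
    for k
  proof -
    have sub: "A k \<subseteq> E" by (auto simp: A_def)
    show ?thesis
      by (rule fsigma_split_urysohn[OF Y(1)
            hereditarily_irresolvable_fsigma_split[OF cr E irr sub]]) (use sub E in blast)+
  qed
  then obtain h g where h: "\<And>k n. continuous_map Y euclideanreal (h k n)"
    "\<And>k n p. p \<in> topspace Y \<Longrightarrow> \<bar>h k n p\<bar> \<le> 1"
    and lim: "\<And>k p. p \<in> topspace Y \<Longrightarrow> (\<lambda>n. h k n p) \<longlonglongrightarrow> g k p"
    and g: "\<And>k p. p \<in> A k \<Longrightarrow> g k p = 1" "\<And>k p. p \<in> E - A k \<Longrightarrow> g k p = -1"
    by metis
  have "(\<lambda>p. \<Sum>k. g k p * (M / 2 ^ Suc k)) \<in> baire_one Y"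
  proof (rule baire_one_suminf)
    show "continuous_map Y euclideanreal (\<lambda>p. h k n p * (M / 2 ^ Suc k))" for k n
      by (intro continuous_map_real_mult_right h)
    show "\<bar>h k n p * (M / 2 ^ Suc k)\<bar> \<le> M / 2 ^ Suc k" if "p \<in> topspace Y" for k n p
      using mult_right_mono[OF h(2)[OF that], of "M / 2 ^ Suc k" k n] M(1) by (simp add: abs_mult)
    show "summable (\<lambda>k. M / 2 ^ Suc k)"
    proof -
      have "summable (\<lambda>k. M / 2 * (1/2) ^ k)"
        by (intro summable_mult summable_geometric) auto
      then show ?thesis by (simp add: power_one_over field_simps)
    qed
    show "(\<lambda>n. h k n p * (M / 2 ^ Suc k)) \<longlonglongrightarrow> g k p * (M / 2 ^ Suc k)"
      if "p \<in> topspace Y" for k p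
      by (intro tendsto_mult_right lim that)
  qed
  moreover have "(\<Sum>k. g k x * (M / 2 ^ Suc k)) = f x" if x: "x \<in> E" for x
  proof -
    have "g k x = (if s k (f x) then 1 else -1)" for k
      using g[of x k] x by (auto simp: A_def)
    then show ?thesis
      using sums_unique[OF s[OF M(2)[OF x]]] by simp
  qed
  ultimately show "\<exists>g \<in> baire_one Y. \<forall>x \<in> E. g x = f x"
    by (intro bexI[rotated]) auto
qed

section \<open>The Stone--Cech compactification\<close>

lemma homeomorphic_map_dense_subset:
  assumes "homeomorphic_map X Y f" "A \<subseteq> topspace X"
  shows "dense_subset Y (f ` A) \<longleftrightarrow> dense_subset X A"
proof -
  have im: "f ` topspace X = topspace Y" and inj: "inj_on f (topspace X)"
    using assms(1) by (auto simp: homeomorphic_eq_everything_map)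
  have "f ` (X closure_of A) = f ` topspace X \<longleftrightarrow> X closure_of A = topspace X"
    by (rule inj_on_image_eq_iff[OF inj closure_of_subset_topspace order_refl])
  then show ?thesis
    using assms(2) im homeomorphic_map_closure_of[OF assms]
    unfolding dense_subset_def by (metis image_mono)
qed

lemma homeomorphic_irresolvable_space:
  assumes "homeomorphic_map X Y f" "irresolvable_space Y"
  shows "irresolvable_space X"
  unfolding irresolvable_space_def
proof safe
  have im: "f ` topspace X = topspace Y" and inj: "inj_on f (topspace X)"
    using assms(1) by (auto simp: homeomorphic_eq_everything_map)
  fix A B assume AB: "dense_subset X A" "dense_subset X B" "A \<inter> B = {}" "A \<union> B = topspace X"
  then have "dense_subset Y (f ` A)" "dense_subset Y (f ` B)"
    using homeomorphic_map_dense_subset[OF assms(1)] by (auto simp: dense_subset_def)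
  moreover have "f ` A \<inter> f ` B = {}"
    using AB inj by (metis Un_upper1 Un_upper2 image_is_empty inj_on_image_Int)
  moreover have "f ` A \<union> f ` B = topspace Y"
    using AB(4) im by (metis image_Un)
  ultimately show False
    using assms(2) unfolding irresolvable_space_def by blast
qed

lemma homeomorphic_hereditarily_irresolvable_space:
  assumes "homeomorphic_map X Y f" "hereditarily_irresolvable_space Y"
  shows "hereditarily_irresolvable_space X"
  unfolding hereditarily_irresolvable_space_def
proof (intro allI impI)
  have im: "f ` topspace X = topspace Y"
    using assms(1) by (auto simp: homeomorphic_eq_everything_map)
  fix S assume S: "S \<subseteq> topspace X \<and> S \<noteq> {}"
  then have "f ` S \<subseteq> topspace Y" "f ` S \<noteq> {}" using im by auto
  then have "irresolvable_space (subtopology Y (f ` S))"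
    using assms(2) unfolding hereditarily_irresolvable_space_def by blast
  moreover have "homeomorphic_map (subtopology X S) (subtopology Y (f ` S)) f"
    using S im by (intro homeomorphic_map_subtopologies[OF assms(1)]) blast
  ultimately show "irresolvable_space (subtopology X S)"
    by (rule homeomorphic_irresolvable_space[rotated])
qed

lemma homeomorphic_isolated_point:
  assumes "homeomorphic_map X Y f" "isolated_point X x"
  shows "isolated_point Y (f x)"
  using assms
  unfolding isolated_point_def
  by (metis homeomorphic_imp_surjective_map homeomorphic_map_openness image_empty image_eqI image_insert openin_subset)

theorem theorem3p7:
  fixes X :: "'a topology"
  assumes "topspace X \<noteq> {}"
    and "countable (topspace X)"
    and "hereditarily_irresolvable_space X"
    and "completely_regular_space X"
    and "Hausdorff_space X"
    and "\<not> (\<exists>x. isolated_point X x)"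
  shows "B1_star_embedded (stone_cech X) (stone_cech_map X ` topspace X) \<and>
         \<not> B1_embedded (stone_cech X) (stone_cech_map X ` topspace X)"
proof -
  let ?Y = "stone_cech X" and ?E = "stone_cech_map X ` topspace X"
  have "homeomorphic_map X (subtopology ?Y ?E) (stone_cech_map X)"
    using embedding_map_stone_cech[OF assms(4,5)] by (simp add: embedding_map_def)
  \<comment> \<open>The inverse direction serves both transfers: irresolvability is pulled back
    along \<open>j\<close>, and an isolated point of the image would be pushed forward to one of
    \<open>X\<close>.\<close>
  then obtain j where j: "homeomorphic_map (subtopology ?Y ?E) X j"
    by (metis homeomorphic_map_maps homeomorphic_maps_sym)
  have E: "?E \<subseteq> topspace ?Y" "countable ?E"
    using dense_subset_stone_cech[of X] assms(2) by (auto simp: dense_subset_def)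
  have Y: "compact_space ?Y" "Hausdorff_space ?Y"
    by (rule compact_space_stone_cech Hausdorff_space_stone_cech)+
  have "normal_space ?Y"
    using Y by (simp add: compact_Hausdorff_or_regular_imp_normal_space)
  then have "B1_star_embedded ?Y ?E"
    using Y E homeomorphic_hereditarily_irresolvable_space[OF j assms(3)]
    by (intro B1_star_embedded_countable_irresolvable)
  moreover have "\<not> B1_embedded ?Y ?E"
  proof (rule not_B1_embedded_countable_dense[OF Y _ E(2) dense_subset_stone_cech])
    show "topspace ?Y \<noteq> {}" using E(1) assms(1) by blast
    show "\<nexists>x. isolated_point (subtopology ?Y ?E) x"
      using homeomorphic_isolated_point[OF j] assms(6) by blast
  qed
  ultimately show ?thesis by blast
qed

end
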